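(* Let $\mathcal{H}$ be a complex separable Hilbert space and let $T$ be a linear relation on $\mathcal{H}$. Then: 1. $T$ is a multivalued projection if and only if $I_{\operatorname{ran}T}\subseteq T$. 2. $T$ is a multivalued nilpotent if and only if $\operatorname{ran}T\subseteq\ker T$.
   Context: A linear relation on $\mathcal{H}$ is a linear subspace $T$ of $\mathcal{H}\times\mathcal{H}$; $\operatorname{dom}T$, $\operatorname{ran}T$ are the sets of first, resp. second, components, $\ker T=\{x:(x,0)\in T\}$, $\operatorname{mul}T=\{y:(0,y)\in T\}$. The product of relations is $RT=\{(x,y):(x,z)\in T,(z,y)\in R\text{ for some }z\}$. For a subspace $\mathcal{M}$, $I_{\mathcal{M}}=\{(u,u):u\in\mathcal{M}\}$. A relation $T$ is a multivalued projection if $\operatorname{ran}T\subseteq\operatorname{dom}T$ and $T^2=T$; it is a multivalued nilpotent if $\operatorname{ran}T\subseteq\operatorname{dom}T$ and $T^2=\operatorname{dom}T\times\operatorname{mul}T$. *)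

theory Defs
  imports "HOL-Analysis.Analysis"
begin

subsection \<open>Complex Hilbert spaces\<close>

class complex_vector = real_vector +
  fixes scaleC :: "complex \<Rightarrow> 'a \<Rightarrow> 'a" (infixr "*\<^sub>C" 75)
  assumes scaleC_add_right: "a *\<^sub>C (x + y) = a *\<^sub>C x + a *\<^sub>C y"
    and scaleC_add_left: "(a + b) *\<^sub>C x = a *\<^sub>C x + b *\<^sub>C x"
    and scaleC_scaleC: "a *\<^sub>C b *\<^sub>C x = (a * b) *\<^sub>C x"
    and scaleC_one: "1 *\<^sub>C x = x"
    and scaleR_scaleC: "r *\<^sub>R x = complex_of_real r *\<^sub>C x"

interpretation complex_vector: vector_space "scaleC :: complex \<Rightarrow> 'a \<Rightarrow> 'a::complex_vector"
  by unfold_locales (simp_all add: scaleC_add_right scaleC_add_left scaleC_scaleC scaleC_one)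

instantiation prod :: (complex_vector, complex_vector) complex_vector
begin

definition scaleC_prod :: "complex \<Rightarrow> 'a \<times> 'b \<Rightarrow> 'a \<times> 'b"
  where "scaleC_prod a p = (a *\<^sub>C fst p, a *\<^sub>C snd p)"

instance
  by standard
    (simp_all add: scaleC_prod_def scaleC_add_right scaleC_add_left scaleC_scaleC scaleC_one
      scaleR_prod_def scaleR_scaleC)

end

(* The inner product is linear in its first argument.  The metric, topology and uniformity are
   those of the norm it induces (class real_normed_vector), so completeness and density below
   are with respect to that norm. *)
class complex_inner = complex_vector + real_normed_vector +
  fixes cinner :: "'a \<Rightarrow> 'a \<Rightarrow> complex"
  assumes cinner_commute: "cinner x y = cnj (cinner y x)"
    and cinner_add_left: "cinner (x + y) z = cinner x z + cinner y z"
    and cinner_scaleC_left: "cinner (a *\<^sub>C x) y = a * cinner x y"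
    and norm_power2_eq_cinner: "complex_of_real ((norm x)\<^sup>2) = cinner x x"

class chilbert_space = complex_inner + complete_space

subsection \<open>Linear relations\<close>

(* Domain, range and the identity on a subspace are the library's Domain, Range and Id_on. *)

definition linear_relation :: "('a::complex_vector \<times> 'a) set \<Rightarrow> bool"
  where "linear_relation T \<longleftrightarrow> complex_vector.subspace T"

definition ker_rel :: "('a::zero \<times> 'a) set \<Rightarrow> 'a set"
  where "ker_rel T = {x. (x, 0) \<in> T}"

definition mul_rel :: "('a::zero \<times> 'a) set \<Rightarrow> 'a set"
  where "mul_rel T = {y. (0, y) \<in> T}"

(* The product of relations applies its right factor first, whereas relcomp applies its left
   factor first. *)
definition rel_prod :: "('a \<times> 'a) set \<Rightarrow> ('a \<times> 'a) set \<Rightarrow> ('a \<times> 'a) set"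
  where "rel_prod R T = T O R"

definition mv_projection :: "('a::complex_vector \<times> 'a) set \<Rightarrow> bool"
  where "mv_projection T \<longleftrightarrow> linear_relation T \<and> Range T \<subseteq> Domain T \<and> rel_prod T T = T"

definition mv_nilpotent :: "('a::complex_vector \<times> 'a) set \<Rightarrow> bool"
  where "mv_nilpotent T \<longleftrightarrow>
    linear_relation T \<and> Range T \<subseteq> Domain T \<and> rel_prod T T = Domain T \<times> mul_rel T"

end

theory Submission
  imports Defs
begin

text \<open>By linearity, two pairs of \<open>T\<close> with the same first component differ by some
  \<open>(0, m)\<close> with \<open>m\<close> in \<open>mul_rel T\<close>, and adding such a pair to
  a pair of \<open>T\<close> stays in \<open>T\<close>. Both equivalences come from this correction
  by \<open>mul_rel T\<close>: for \<open>(x, y)\<close> and \<open>(y, w)\<close> in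
  \<open>T\<close>, the condition on the square puts \<open>y - w\<close> (projection) or
  \<open>w\<close> (nilpotent) into \<open>mul_rel T\<close>, which turns \<open>(y, w)\<close> into
  \<open>(y, y)\<close> or \<open>(y, 0)\<close>. The converses run the same correction
  backwards.\<close>

lemma linear_relation_add:
  assumes "linear_relation T" "(x, y) \<in> T" "(x', y') \<in> T"
  shows "(x + x', y + y') \<in> T"
  using complex_vector.subspace_add[OF assms[unfolded linear_relation_def]] by simp

lemma linear_relation_diff:
  assumes "linear_relation T" "(x, y) \<in> T" "(x', y') \<in> T"
  shows "(x - x', y - y') \<in> T"
  using complex_vector.subspace_diff[OF assms[unfolded linear_relation_def]] by simp

lemma mv_projection_iff:
  assumes T: "linear_relation T"
  shows "mv_projection T \<longleftrightarrow> Id_on (Range T) \<subseteq> T"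
proof
  assume proj: "mv_projection T"
  show "Id_on (Range T) \<subseteq> T"
  proof clarify
    fix x y assume xy: "(x, y) \<in> T"
    with proj obtain w where yw: "(y, w) \<in> T"
      unfolding mv_projection_def by blast
    with xy have "(x, w) \<in> T O T"
      by blast
    with proj have "(x, w) \<in> T"
      by (simp add: mv_projection_def rel_prod_def)
    \<comment> \<open>Both \<open>y\<close> and \<open>w\<close> are images of \<open>x\<close>;
      adding their difference to the image \<open>w\<close> of \<open>y\<close> then gives
      \<open>(y, y)\<close>.\<close>
    with T xy have "(0, y - w) \<in> T"
      using linear_relation_diff by fastforce
    with T yw show "(y, y) \<in> T"
      using linear_relation_add by fastforce
  qed
next
  assume "Id_on (Range T) \<subseteq> T"
  then have id: "(y, y) \<in> T" if "(x, y) \<in> T" for x y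
    using that by blast
  have "(x, y) \<in> T" if "(x, z) \<in> T" "(z, y) \<in> T" for x y z
  proof -
    \<comment> \<open>Here \<open>z\<close> lies in the range, so \<open>(z, z)\<close> can be
      subtracted from \<open>(z, y)\<close>.\<close>
    from T that id have "(0, y - z) \<in> T"
      using linear_relation_diff by fastforce
    with T that(1) show ?thesis
      using linear_relation_add by fastforce
  qed
  then have "T O T \<subseteq> T"
    by (auto elim!: relcompE)
  \<comment> \<open>A pair \<open>(x, y)\<close> factors through \<open>y\<close> itself, by
    \<open>(y, y)\<close>.\<close>
  moreover have "T \<subseteq> T O T" and "Range T \<subseteq> Domain T"
    using id by (auto intro: relcompI)
  ultimately show "mv_projection T"
    using T unfolding mv_projection_def rel_prod_def by blast
qed

lemma mv_nilpotent_iff: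
  assumes T: "linear_relation T"
  shows "mv_nilpotent T \<longleftrightarrow> Range T \<subseteq> ker_rel T"
proof
  assume nil: "mv_nilpotent T"
  show "Range T \<subseteq> ker_rel T"
  proof clarify
    fix x y assume xy: "(x, y) \<in> T"
    with nil obtain w where yw: "(y, w) \<in> T"
      unfolding mv_nilpotent_def by blast
    with xy have "(x, w) \<in> T O T"
      by blast
    with nil have "(0, w) \<in> T"
      by (simp add: mv_nilpotent_def rel_prod_def mul_rel_def)
    \<comment> \<open>Subtract \<open>(0, w)\<close> from \<open>(y, w)\<close>.\<close>
    with T yw show "y \<in> ker_rel T"
      using linear_relation_diff by (fastforce simp: ker_rel_def)
  qed
next
  assume "Range T \<subseteq> ker_rel T"
  then have ker: "(y, 0) \<in> T" if "(x, y) \<in> T" for x y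
    using that by (auto simp: ker_rel_def)
  have "(0, w) \<in> T" if "(x, z) \<in> T" "(z, w) \<in> T" for x z w
    using linear_relation_diff[OF T that(2) ker[OF that(1)]] by simp
  \<comment> \<open>Any image \<open>z\<close> of \<open>x\<close> serves as the intermediate point
    from \<open>x\<close> to \<open>w\<close>, because \<open>(z, w)\<close> is
    \<open>(z, 0)\<close> plus \<open>(0, w)\<close>.\<close>
  moreover have "(z, w) \<in> T" if "(x, z) \<in> T" "(0, w) \<in> T" for x z w
    using linear_relation_add[OF T ker[OF that(1)] that(2)] by simp
  ultimately have "T O T = Domain T \<times> mul_rel T"
    unfolding mul_rel_def by blast
  with T ker show "mv_nilpotent T"
    unfolding mv_nilpotent_def rel_prod_def by blast
qed

theorem proposition3p2:
  fixes T :: "('h::chilbert_space \<times> 'h) set"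
  assumes "separable_space (euclidean :: 'h topology)"
    and "linear_relation T"
  shows "(mv_projection T \<longleftrightarrow> Id_on (Range T) \<subseteq> T) \<and>
         (mv_nilpotent T \<longleftrightarrow> Range T \<subseteq> ker_rel T)"
  using assms(2) mv_projection_iff mv_nilpotent_iff by blast

end
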